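(* For each $n\in\mathbb{N}=\{0,1,2,\dots\}$, the assignment $\mathcal{P}^{(n)}\colon \mathbf{Digraph}\to\mathbf{Digraph}$, $\mathcal{G}\mapsto \mathcal{PG}^{(n)}$, sending a digraph to its $n$-path digraph (with the induced action on morphisms described in the context), is an endofunctor of the category $\mathbf{Digraph}$ of directed graphs.
   Context: A digraph is a pair $\mathcal{G}=(V,E)$ with $V$ a finite set of vertices and $E\subseteq (V\times V)\setminus\{(v,v): v\in V\}$ a set of directed edges (no loops; reciprocal edges $(v,w),(w,v)$ are both allowed; the empty digraph is allowed). A morphism of digraphs $(V_1,E_1)\to(V_2,E_2)$ is a function $\phi\colon V_1\to V_2$ such that $(\phi(v),\phi(w))\in E_2$ for every $(v,w)\in E_1$. Finite digraphs and these morphisms form the category $\mathbf{Digraph}$. The directed flag complex $\mathrm{dFl}(\mathcal{G})$ has as $k$-simplices the ordered $(k+1)$-cliques of $\mathcal{G}$, i.e. tuples $[v_0,\dots,v_k]$ of vertices with $(v_i,v_j)\in E$ for all $i<j$. The face map $d_j$ deletes the $j$-th entry: $d_j[v_0,\dots,v_k]=[v_0,\dots,\widehat{v_j},\dots,v_k]$, $0\le j\le k$. For $n\ge 1$, the $n$-path digraph $\mathcal{PG}^{(n)}$ of $\mathcal{G}$ has as vertices the $n$-simplices of $\mathrm{dFl}(\mathcal{G})$, and there is a directed edge $(\sigma,\tau)$ if and only if there are an $(n-1)$-simplex $\alpha$ of $\mathrm{dFl}(\mathcal{G})$ and $i,j\in\{0,\dots,n\}$ with $i<j$ such that $d_i(\sigma)=\alpha=d_j(\tau)$.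 For $n=0$, $\mathcal{PG}^{(0)}=\mathcal{G}$. On a morphism $\phi\colon\mathcal{G}_1\to\mathcal{G}_2$, $\mathcal{P}^{(n)}(\phi)$ is given on vertices by $[v_0,\dots,v_n]\mapsto[\phi(v_0),\dots,\phi(v_n)]$ (and $\mathcal{P}^{(0)}(\phi)=\phi$). *)

theory Defs
  imports "HOL-Library.FuncSet" "Graph_Theory.Pair_Digraph"
begin

section \<open>Categories and functors\<close>

text \<open>
  Only composable pairs are constrained: \<open>cmp C g f\<close> is the composite
  \<open>g\<close> after \<open>f\<close>, and is meaningful when \<open>cod C f = dom C g\<close>.
\<close>

record ('o, 'm) category_data =
  ob  :: "'o set"
  ar  :: "'m set"
  dom :: "'m \<Rightarrow> 'o"
  cod :: "'m \<Rightarrow> 'o"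
  idt :: "'o \<Rightarrow> 'm"
  cmp :: "'m \<Rightarrow> 'm \<Rightarrow> 'm"

locale category =
  fixes C :: "('o, 'm) category_data"
  assumes dom_ob: "f \<in> ar C \<Longrightarrow> dom C f \<in> ob C"
    and cod_ob: "f \<in> ar C \<Longrightarrow> cod C f \<in> ob C"
    and idt_ar: "A \<in> ob C \<Longrightarrow> idt C A \<in> ar C"
    and dom_idt: "A \<in> ob C \<Longrightarrow> dom C (idt C A) = A"
    and cod_idt: "A \<in> ob C \<Longrightarrow> cod C (idt C A) = A"
    and cmp_ar: "\<lbrakk>f \<in> ar C; g \<in> ar C; cod C f = dom C g\<rbrakk> \<Longrightarrow> cmp C g f \<in> ar C"
    and dom_cmp: "\<lbrakk>f \<in> ar C; g \<in> ar C; cod C f = dom C g\<rbrakk> \<Longrightarrow> dom C (cmp C g f) = dom C f"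
    and cod_cmp: "\<lbrakk>f \<in> ar C; g \<in> ar C; cod C f = dom C g\<rbrakk> \<Longrightarrow> cod C (cmp C g f) = cod C g"
    and cmp_idt_right: "f \<in> ar C \<Longrightarrow> cmp C f (idt C (dom C f)) = f"
    and cmp_idt_left: "f \<in> ar C \<Longrightarrow> cmp C (idt C (cod C f)) f = f"
    and cmp_assoc: "\<lbrakk>f \<in> ar C; g \<in> ar C; h \<in> ar C; cod C f = dom C g; cod C g = dom C h\<rbrakk>
      \<Longrightarrow> cmp C h (cmp C g f) = cmp C (cmp C h g) f"

locale category_functor = C: category C + D: category D
  for C :: "('o1, 'm1) category_data" and D :: "('o2, 'm2) category_data" +
  fixes F_ob :: "'o1 \<Rightarrow> 'o2" and F_ar :: "'m1 \<Rightarrow> 'm2"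
  assumes F_ob: "A \<in> ob C \<Longrightarrow> F_ob A \<in> ob D"
    and F_ar: "f \<in> ar C \<Longrightarrow> F_ar f \<in> ar D"
    and F_dom: "f \<in> ar C \<Longrightarrow> dom D (F_ar f) = F_ob (dom C f)"
    and F_cod: "f \<in> ar C \<Longrightarrow> cod D (F_ar f) = F_ob (cod C f)"
    and F_idt: "A \<in> ob C \<Longrightarrow> F_ar (idt C A) = idt D (F_ob A)"
    and F_cmp: "\<lbrakk>f \<in> ar C; g \<in> ar C; cod C f = dom C g\<rbrakk>
      \<Longrightarrow> F_ar (cmp C g f) = cmp D (F_ar g) (F_ar f)"

abbreviation endofunctor ::
  "('o, 'm) category_data \<Rightarrow> ('o \<Rightarrow> 'o) \<Rightarrow> ('m \<Rightarrow> 'm) \<Rightarrow> bool" where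
  "endofunctor C \<equiv> category_functor C C"


section \<open>The category of finite digraphs\<close>

text \<open>
  The predicate \<^const>\<open>pair_digraph\<close> says: finitely many vertices, arcs are pairs of
  vertices, no loops. A morphism carries its source and target, and its vertex map is
  \<^const>\<open>undefined\<close> off the vertices of the source, so that equality of morphisms is
  equality of functions between the vertex sets.
\<close>

record 'v digraph_mor =
  src :: "'v pair_pre_digraph"
  vmap :: "'v \<Rightarrow> 'v"
  tgt :: "'v pair_pre_digraph"

definition digraph_morphism :: "'v digraph_mor \<Rightarrow> bool" where
  "digraph_morphism f \<longleftrightarrow>
     pair_digraph (src f) \<and> pair_digraph (tgt f) \<and>
     vmap f \<in> pverts (src f) \<rightarrow>\<^sub>E pverts (tgt f) \<and>
     (\<forall>(v, w) \<in> parcs (src f). (vmap f v, vmap f w) \<in> parcs (tgt f))"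

definition Digraph :: "('v pair_pre_digraph, 'v digraph_mor) category_data" where
  "Digraph =
    \<lparr> ob = {G. pair_digraph G},
      ar = {f. digraph_morphism f},
      dom = src,
      cod = tgt,
      idt = (\<lambda>G. \<lparr> src = G, vmap = restrict id (pverts G), tgt = G \<rparr>),
      cmp = (\<lambda>g f. \<lparr> src = src f, vmap = compose (pverts (src f)) (vmap g) (vmap f),
                     tgt = tgt g \<rparr>) \<rparr>"


section \<open>Directed flag complexes and path digraphs\<close>

text \<open>The \<open>k\<close>-simplices of the directed flag complex, that is, the ordered \<open>(k+1)\<close>-cliques.\<close>

definition dFl :: "'v pair_pre_digraph \<Rightarrow> nat \<Rightarrow> 'v list set" where
  "dFl G k = {\<sigma>. length \<sigma> = k + 1 \<and> set \<sigma> \<subseteq> pverts G \<and>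
                  (\<forall>i j. i < j \<and> j \<le> k \<longrightarrow> (\<sigma> ! i, \<sigma> ! j) \<in> parcs G)}"

definition face :: "nat \<Rightarrow> 'v list \<Rightarrow> 'v list" where
  "face j \<sigma> = take j \<sigma> @ drop (Suc j) \<sigma>"

text \<open>
  The vertices of a path digraph are tuples of vertices of the given digraph. For the
  construction to map a category of digraphs to itself, vertices are taken from a universe
  that is closed under forming finite tuples: nested tuples over arbitrary atoms \<open>'a\<close>.
  Every digraph on a type \<open>'a\<close> is one on \<open>'a vertex\<close> via \<open>Atom\<close>; the digraphs
  considered may have any elements of \<open>'a vertex\<close> as vertices, mixed depths included.
\<close>

datatype 'a vertex = Atom 'a | Tup (entries: "'a vertex list")

definition path_digraph ::
  "nat \<Rightarrow> 'a vertex pair_pre_digraph \<Rightarrow> 'a vertex pair_pre_digraph" where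
  "path_digraph n G =
    (if n = 0 then G
     else \<lparr> pverts = Tup ` dFl G n,
            parcs = {(Tup \<sigma>, Tup \<tau>) | \<sigma> \<tau>. \<sigma> \<in> dFl G n \<and> \<tau> \<in> dFl G n \<and>
                       (\<exists>\<alpha> \<in> dFl G (n - 1). \<exists>i j. i < j \<and> j \<le> n \<and>
                          face i \<sigma> = \<alpha> \<and> face j \<tau> = \<alpha>)} \<rparr>)"

definition path_morphism :: "nat \<Rightarrow> 'a vertex digraph_mor \<Rightarrow> 'a vertex digraph_mor" where
  "path_morphism n \<phi> =
    (if n = 0 then \<phi>
     else \<lparr> src = path_digraph n (src \<phi>),
            vmap = (\<lambda>x \<in> pverts (path_digraph n (src \<phi>)). Tup (map (vmap \<phi>) (entries x))),
            tgt = path_digraph n (tgt \<phi>) \<rparr>)"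

end

theory Submission
  imports Defs
begin

text \<open>
  A digraph morphism preserves edges, hence sends ordered cliques to ordered cliques, and the
  entrywise action on tuples commutes with the face maps; so it preserves the edges of path
  digraphs. The path digraph has no loops: if \<open>d\<^sub>i \<sigma> = d\<^sub>j \<sigma>\<close> with \<open>i < j\<close>, comparing the entries in
  position \<open>i\<close> gives \<open>\<sigma>\<^sub>i\<^sub>+\<^sub>1 = \<sigma>\<^sub>i\<close>, although these vertices are joined by an edge of a loopless digraph.
\<close>

text \<open>Unpacks the locale into plain set conditions. Finiteness of the arc set comes for free,
  since the arcs lie in a product of two finite sets.\<close>

lemma pair_digraph_iff:
  "pair_digraph G \<longleftrightarrow>
     finite (pverts G) \<and> parcs G \<subseteq> pverts G \<times> pverts G \<and> (\<forall>v. (v, v) \<notin> parcs G)"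
proof
  assume "pair_digraph G"
  then interpret pair_digraph G .
  show "finite (pverts G) \<and> parcs G \<subseteq> pverts G \<times> pverts G \<and> (\<forall>v. (v, v) \<notin> parcs G)"
    using pair_finite_verts by (auto dest: in_arcsD1 in_arcsD2 no_loops')
next
  assume G: "finite (pverts G) \<and> parcs G \<subseteq> pverts G \<times> pverts G \<and> (\<forall>v. (v, v) \<notin> parcs G)"
  then have "finite (parcs G)"
    by (meson finite_SigmaI finite_subset)
  with G show "pair_digraph G"
    by unfold_locales auto
qed

lemma digraph_morphism_idt:
  assumes "pair_digraph G"
  shows "digraph_morphism (idt Digraph G)"
proof -
  \<comment> \<open>The restricted identity fixes only vertices, so preservation of arcs requires
    their endpoints to be vertices.\<close>
  have "parcs G \<subseteq> pverts G \<times> pverts G"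
    using assms by (simp add: pair_digraph_iff)
  with assms show ?thesis
    by (auto simp: Digraph_def digraph_morphism_def)
qed

lemma digraph_morphism_cmp:
  assumes "digraph_morphism f" "digraph_morphism g" "tgt f = src g"
  shows "digraph_morphism (cmp Digraph g f)"
proof -
  have "parcs (src f) \<subseteq> pverts (src f) \<times> pverts (src f)"
    using assms by (simp add: digraph_morphism_def pair_digraph_iff)
  with assms show ?thesis
    by (fastforce simp: Digraph_def digraph_morphism_def compose_def)
qed

lemma category_Digraph: "category Digraph"
proof
  fix f g h :: "'v digraph_mor"
  assume "f \<in> ar Digraph" "g \<in> ar Digraph" "h \<in> ar Digraph"
    "cod Digraph f = category_data.dom Digraph g" "cod Digraph g = category_data.dom Digraph h"
  then show "cmp Digraph h (cmp Digraph g f) = cmp Digraph (cmp Digraph h g) f"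
    by (auto simp: Digraph_def digraph_morphism_def intro: compose_assoc)
next
  fix f :: "'v digraph_mor"
  assume "f \<in> ar Digraph"
  \<comment> \<open>Composition resets values off the source's vertices to \<open>undefined\<close>.
    Extensionality says that \<open>vmap f\<close> already has these values, so the unit laws are
    true equalities.\<close>
  then have f: "vmap f \<in> pverts (src f) \<rightarrow> pverts (tgt f)" "vmap f \<in> extensional (pverts (src f))"
    by (simp_all add: Digraph_def digraph_morphism_def PiE_def)
  show "cmp Digraph f (idt Digraph (category_data.dom Digraph f)) = f"
    by (simp add: Digraph_def id_def compose_Id[OF f])
  show "cmp Digraph (idt Digraph (cod Digraph f)) f = f"
    by (simp add: Digraph_def id_def Id_compose[OF f])
next
  fix f g :: "'v digraph_mor"
  assume "f \<in> ar Digraph" "g \<in> ar Digraph" "cod Digraph f = category_data.dom Digraph g"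
  then show "cmp Digraph g f \<in> ar Digraph"
    using digraph_morphism_cmp[of f g] by (simp add: Digraph_def)
next
  fix G :: "'v pair_pre_digraph"
  assume "G \<in> ob Digraph"
  then show "idt Digraph G \<in> ar Digraph"
    using digraph_morphism_idt[of G] by (simp add: Digraph_def)
qed (simp_all add: Digraph_def digraph_morphism_def)

lemma finite_dFl: "finite (pverts G) \<Longrightarrow> finite (dFl G n)"
  by (rule finite_subset[OF _ finite_lists_length_eq[of "pverts G" "n + 1"]])
    (auto simp: dFl_def)

lemma nth_face:
  assumes "i < length \<sigma>" "j < length \<sigma> - 1"
  shows "face i \<sigma> ! j = \<sigma> ! (if j < i then j else Suc j)"
  using assms by (auto simp: face_def nth_append)

lemma face_eq_imp_arc_loop:
  assumes "\<sigma> \<in> dFl G n" "i < j" "j \<le> n" "face i \<sigma> = face j \<sigma>"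
  shows "\<exists>v. (v, v) \<in> parcs G"
proof -
  have len: "length \<sigma> = n + 1"
    using assms by (simp add: dFl_def)
  \<comment> \<open>Position \<open>i\<close> is the first one shifted by deleting entry
    \<open>i\<close>, while deleting the later entry \<open>j\<close> leaves it alone. It exists in
    both faces because \<open>i < j\<close> and \<open>j \<le> n\<close>.\<close>
  have "face i \<sigma> ! i = \<sigma> ! Suc i" "face j \<sigma> ! i = \<sigma> ! i"
    using assms(2,3) len by (simp_all add: nth_face)
  then have "\<sigma> ! Suc i = \<sigma> ! i"
    using assms(4) by simp
  moreover have "(\<sigma> ! i, \<sigma> ! Suc i) \<in> parcs G"
    using assms by (auto simp: dFl_def)
  ultimately show ?thesis
    by auto
qed

lemma map_face: "map f (face j \<sigma>) = face j (map f \<sigma>)"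
  by (simp add: face_def take_map drop_map)

lemma pverts_path_digraph: "n \<noteq> 0 \<Longrightarrow> pverts (path_digraph n G) = Tup ` dFl G n"
  by (simp add: path_digraph_def)

lemma pair_digraph_path_digraph:
  assumes "pair_digraph G"
  shows "pair_digraph (path_digraph n G)"
  using assms by (auto simp: pair_digraph_iff path_digraph_def finite_dFl dest: face_eq_imp_arc_loop)

lemma src_path_morphism: "src (path_morphism n f) = path_digraph n (src f)"
  and tgt_path_morphism: "tgt (path_morphism n f) = path_digraph n (tgt f)"
  by (simp_all add: path_morphism_def path_digraph_def)

text \<open>Being a clique is a condition on arcs between positions, and \<open>map\<close> keeps
  positions while \<open>vmap f\<close> keeps arcs.\<close>

lemma map_in_dFl:
  assumes "digraph_morphism f" "\<sigma> \<in> dFl (src f) k"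
  shows "map (vmap f) \<sigma> \<in> dFl (tgt f) k"
  using assms by (auto simp: digraph_morphism_def dFl_def PiE_iff)

lemma digraph_morphism_path_morphism:
  assumes f: "digraph_morphism f"
  shows "digraph_morphism (path_morphism n f)"
proof (cases "n = 0")
  case False
  have "(Tup (map (vmap f) \<sigma>), Tup (map (vmap f) \<tau>)) \<in> parcs (path_digraph n (tgt f))"
    if "(Tup \<sigma>, Tup \<tau>) \<in> parcs (path_digraph n (src f))" for \<sigma> \<tau>
  proof -
    from that False obtain i j where
      "\<sigma> \<in> dFl (src f) n" "\<tau> \<in> dFl (src f) n" "face i \<sigma> \<in> dFl (src f) (n - 1)"
      and ij: "i < j" "j \<le> n" and eq: "face i \<sigma> = face j \<tau>"
      unfolding path_digraph_def by force
    \<comment> \<open>The image arc is witnessed by the same \<open>i\<close> and \<open>j\<close>.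
      The common face is the image of the old one, as \<open>map\<close> commutes with
      \<open>face\<close>.\<close>
    then have "map (vmap f) \<sigma> \<in> dFl (tgt f) n" "map (vmap f) \<tau> \<in> dFl (tgt f) n"
      "face i (map (vmap f) \<sigma>) \<in> dFl (tgt f) (n - 1)"
      by (simp_all add: map_in_dFl[OF f] flip: map_face)
    moreover have "face i (map (vmap f) \<sigma>) = face j (map (vmap f) \<tau>)"
      using eq by (simp flip: map_face)
    ultimately show ?thesis
      using False ij unfolding path_digraph_def by auto
  qed
  \<comment> \<open>Every arc thus has the form \<open>(Tup \<sigma>, Tup \<tau>)\<close> with both
    ends in the set where the restricted vertex map acts entrywise.\<close>
  moreover have "parcs (path_digraph n (src f)) \<subseteq> Tup ` dFl (src f) n \<times> Tup ` dFl (src f) n"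
    using False by (auto simp: path_digraph_def)
  ultimately have arcs: "\<forall>(v, w) \<in> parcs (path_digraph n (src f)).
      (vmap (path_morphism n f) v, vmap (path_morphism n f) w) \<in> parcs (path_digraph n (tgt f))"
    using False by (fastforce simp: path_morphism_def pverts_path_digraph)
  have "vmap (path_morphism n f)
      \<in> pverts (path_digraph n (src f)) \<rightarrow>\<^sub>E pverts (path_digraph n (tgt f))"
    using False by (auto simp: path_morphism_def pverts_path_digraph map_in_dFl[OF f])
  with arcs f show ?thesis
    by (simp add: digraph_morphism_def src_path_morphism tgt_path_morphism
        pair_digraph_path_digraph)
qed (use f in \<open>simp add: path_morphism_def\<close>)

lemma path_morphism_idt:
  "path_morphism n (idt Digraph G) = idt Digraph (path_digraph n G)"
proof (cases "n = 0")
  case False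
  \<comment> \<open>The entries of a simplex are vertices, so the restriction is invisible on
    them.\<close>
  have "map (restrict id (pverts G)) \<sigma> = \<sigma>" if "\<sigma> \<in> dFl G n" for \<sigma>
    using that by (intro map_idI) (auto simp: dFl_def)
  with False show ?thesis
    by (auto simp: Digraph_def path_morphism_def path_digraph_def intro!: restrict_ext)
qed (simp add: Digraph_def path_morphism_def path_digraph_def)

lemma path_morphism_cmp:
  assumes f: "digraph_morphism f" and fg: "tgt f = src g"
  shows "path_morphism n (cmp Digraph g f) = cmp Digraph (path_morphism n g) (path_morphism n f)"
proof (cases "n = 0")
  case False
  have "map (compose (pverts (src f)) (vmap g) (vmap f)) \<sigma> = map (vmap g) (map (vmap f) \<sigma>)"
    if "\<sigma> \<in> dFl (src f) n" for \<sigma>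
    using that by (auto simp: dFl_def compose_def)
  with False show ?thesis
    \<comment> \<open>The intermediate tuple is a simplex of \<open>tgt f = src g\<close>, hence
      lies where \<open>path_morphism n g\<close> is given by its formula and not by
      \<open>undefined\<close>.\<close>
    using map_in_dFl[OF f] fg
    by (auto simp: Digraph_def path_morphism_def path_digraph_def compose_def intro!: restrict_ext)
qed (simp add: Digraph_def path_morphism_def)

theorem theorem3p22:
  fixes n :: nat
  shows "endofunctor (Digraph :: ('a vertex pair_pre_digraph, 'a vertex digraph_mor) category_data)
           (path_digraph n) (path_morphism n)"
proof -
  interpret category "Digraph :: ('a vertex pair_pre_digraph, 'a vertex digraph_mor) category_data"
    by (rule category_Digraph)
  show ?thesis
  proof unfold_locales
    fix f g :: "'a vertex digraph_mor"
    assume "f \<in> ar Digraph" "g \<in> ar Digraph" "cod Digraph f = category_data.dom Digraph g"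
    then show "path_morphism n (cmp Digraph g f)
        = cmp Digraph (path_morphism n g) (path_morphism n f)"
      by (intro path_morphism_cmp) (simp_all add: Digraph_def)
  qed (simp_all add: path_morphism_idt, simp_all add: Digraph_def src_path_morphism
      tgt_path_morphism pair_digraph_path_digraph digraph_morphism_path_morphism)
qed

end
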